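(* Let $\mathcal{A}\in\mathbb{C}^{n\times n\times p}$ be a complex tensor with $\mathrm{Ind}_T(\mathcal{A})=k$. For every integer $l\ge k$, $$\mathcal{A}^D=\lim_{z\to0}(\mathcal{A}^{l+1}+z\mathcal{I})^{-1}*\mathcal{A}^l.$$ For every integer $l\ge0$, $$\mathcal{A}^D=\lim_{z\to0}(\mathcal{A}^{l+1}+z\mathcal{I})^{-1}*\mathcal{C}_{\mathcal{A}}^{(l)},$$ where $\mathcal{C}_{\mathcal{A}}^{(l)}=\mathcal{A}^{l+1}*\mathcal{A}^D$.
   Context: For $\mathcal{A}\in\mathbb{C}^{m\times n\times p}$ let $A^{(1)},\dots,A^{(p)}\in\mathbb{C}^{m\times n}$ be its frontal slices. $\mathrm{bcirc}(\mathcal{A})$ is the $mp\times np$ block circulant matrix whose $(i,j)$ block ($1\le i,j\le p$) is $A^{(((i-j)\bmod p)+1)}$; $\mathrm{unfold}(\mathcal{A})$ is the $mp\times n$ matrix obtained by stacking $A^{(1)},\dots,A^{(p)}$ vertically, and $\mathrm{fold}$ is the inverse of $\mathrm{unfold}$. The T-product is $\mathcal{A}*\mathcal{B}=\mathrm{fold}(\mathrm{bcirc}(\mathcal{A})\,\mathrm{unfold}(\mathcal{B}))$; powers and inverses are with respect to $*$ and the identity tensor $\mathcal{I}$ (first frontal slice $I_n$, other slices zero). The limits are over complex $z\neq0$ tending to $0$ (the inverse exists for all small $z\ne0$). The index $\mathrm{Ind}(A)$ of a square matrix $A$ is the smallest positive integer $k$ with $\mathrm{rank}(A^k)=\mathrm{rank}(A^{k+1})$,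 and $\mathrm{Ind}_T(\mathcal{A})=\mathrm{Ind}(\mathrm{bcirc}(\mathcal{A}))$. The T-Drazin inverse $\mathcal{A}^D$ is the unique $\mathcal{X}\in\mathbb{C}^{n\times n\times p}$ with $\mathcal{A}^k*\mathcal{X}*\mathcal{A}=\mathcal{A}^k$, $\mathcal{X}*\mathcal{A}*\mathcal{X}=\mathcal{X}$, $\mathcal{A}*\mathcal{X}=\mathcal{X}*\mathcal{A}$, where $k=\mathrm{Ind}_T(\mathcal{A})$. *)

theory Defs
  imports "HOL-Analysis.Analysis"
begin

(* An m x n x p tensor is the vector, indexed by 'p, of its frontal slices: A $ r is a slice
   and A $ r $ a $ b an entry.  The slices are ordered by the linear order on 'p. *)
type_synonym ('m, 'n, 'p) tensor = "complex ^ 'n ^ 'm ^ 'p"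

(* Slice positions count from 0, so the slice at position r is the frontal slice usually written A^(r+1). *)
definition slice_pos :: "'p::{finite,linorder} \<Rightarrow> nat" where
  "slice_pos i = card {j. j < i}"

definition slice_at :: "nat \<Rightarrow> 'p::{finite,linorder}" where
  "slice_at r = (THE i. slice_pos i = r)"

lemma slice_pos_strict_mono: "i < j \<Longrightarrow> slice_pos i < slice_pos j"
  unfolding slice_pos_def by (rule psubset_card_mono) auto

lemma bij_betw_slice_pos:
  "bij_betw slice_pos (UNIV :: 'p::{finite,linorder} set) {..<CARD('p)}"
proof -
  have inj: "inj (slice_pos :: 'p \<Rightarrow> nat)"
    by (rule injI) (metis less_irrefl linorder_less_linear slice_pos_strict_mono)
  have "slice_pos i < CARD('p)" for i :: 'p
    unfolding slice_pos_def by (rule psubset_card_mono) auto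
  hence "range (slice_pos :: 'p \<Rightarrow> nat) \<subseteq> {..<CARD('p)}"
    by auto
  moreover have "card (range (slice_pos :: 'p \<Rightarrow> nat)) = CARD('p)"
    using inj by (rule card_image)
  ultimately have "range (slice_pos :: 'p \<Rightarrow> nat) = {..<CARD('p)}"
    by (intro card_subset_eq) auto
  with inj show ?thesis
    by (simp add: bij_betw_def)
qed

lemma slice_at_slice_pos [simp]: "slice_at (slice_pos i) = i"
  unfolding slice_at_def using bij_betw_slice_pos
  by (intro the_equality) (auto simp: bij_betw_def dest: injD)

lemma slice_pos_slice_at:
  assumes "r < CARD('p::{finite,linorder})"
  shows "slice_pos (slice_at r :: 'p) = r"
proof -
  obtain i :: 'p where "r = slice_pos i"
    using assms bij_betw_slice_pos by (metis bij_betw_imp_surj_on imageE lessThan_iff)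
  thus ?thesis by simp
qed

(* In the following matrices the row or column index (i, a) is index a within block i. *)
definition bcirc :: "('m::finite, 'n::finite, 'p::{finite,linorder}) tensor
    \<Rightarrow> complex ^ ('p \<times> 'n) ^ ('p \<times> 'm)" where
  "bcirc A = (\<chi> ia jb. A $ slice_at (nat ((int (slice_pos (fst ia)) - int (slice_pos (fst jb)))
                                        mod int CARD('p))) $ snd ia $ snd jb)"

definition tunfold :: "('m::finite, 'n::finite, 'p::finite) tensor
    \<Rightarrow> complex ^ 'n ^ ('p \<times> 'm)" where
  "tunfold A = (\<chi> ia b. A $ fst ia $ snd ia $ b)"

definition tfold :: "complex ^ 'n ^ ('p \<times> 'm)
    \<Rightarrow> ('m::finite, 'n::finite, 'p::finite) tensor" where
  "tfold M = (\<chi> i a b. M $ (i, a) $ b)"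

lemma tfold_tunfold [simp]: "tfold (tunfold A) = A"
  by (simp add: tfold_def tunfold_def vec_eq_iff)

lemma tunfold_tfold [simp]: "tunfold (tfold M) = M"
  by (simp add: tfold_def tunfold_def vec_eq_iff)

definition tprod :: "('m::finite, 'n::finite, 'p::{finite,linorder}) tensor
    \<Rightarrow> ('n, 'q::finite, 'p) tensor \<Rightarrow> ('m, 'q, 'p) tensor"  (infixl "*\<^sub>T" 70) where
  "A *\<^sub>T B = tfold (bcirc A ** tunfold B)"

definition tid :: "('n::finite, 'n, 'p::{finite,linorder}) tensor" where
  "tid = (\<chi> i. if slice_pos i = 0 then mat 1 else 0)"

(* Entrywise: *s scales only the outermost vector level, *_R only by reals, and both * and ^
   on the vector type are Hadamard operations. *)
definition tscale :: "complex \<Rightarrow> ('m::finite, 'n::finite, 'p::finite) tensor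
    \<Rightarrow> ('m, 'n, 'p) tensor" where
  "tscale z A = (\<chi> i a b. z * A $ i $ a $ b)"

primrec tpow :: "('n::finite, 'n, 'p::{finite,linorder}) tensor \<Rightarrow> nat
    \<Rightarrow> ('n, 'n, 'p) tensor" where
  "tpow A 0 = tid"
| "tpow A (Suc k) = A *\<^sub>T tpow A k"

definition is_tinverse :: "('n::finite, 'n, 'p::{finite,linorder}) tensor
    \<Rightarrow> ('n, 'n, 'p) tensor \<Rightarrow> bool" where
  "is_tinverse A X \<longleftrightarrow> A *\<^sub>T X = tid \<and> X *\<^sub>T A = tid"

definition tinvertible :: "('n::finite, 'n, 'p::{finite,linorder}) tensor \<Rightarrow> bool" where
  "tinvertible A \<longleftrightarrow> (\<exists>X. is_tinverse A X)"

definition tinv :: "('n::finite, 'n, 'p::{finite,linorder}) tensor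
    \<Rightarrow> ('n, 'n, 'p) tensor" where
  "tinv A = (THE X. is_tinverse A X)"

primrec matpow :: "complex ^ 'n ^ 'n \<Rightarrow> nat \<Rightarrow> complex ^ 'n ^ 'n::finite" where
  "matpow M 0 = mat 1"
| "matpow M (Suc k) = M ** matpow M k"

definition mat_index :: "complex ^ 'n ^ 'n::finite \<Rightarrow> nat" where
  "mat_index M = (LEAST k. 1 \<le> k \<and> rank (matpow M k) = rank (matpow M (k + 1)))"

definition tindex :: "('n::finite, 'n, 'p::{finite,linorder}) tensor \<Rightarrow> nat" where
  "tindex A = mat_index (bcirc A)"

definition is_tdrazin :: "('n::finite, 'n, 'p::{finite,linorder}) tensor
    \<Rightarrow> ('n, 'n, 'p) tensor \<Rightarrow> bool" where
  "is_tdrazin A X \<longleftrightarrow>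
     tpow A (tindex A) *\<^sub>T X *\<^sub>T A = tpow A (tindex A) \<and>
     X *\<^sub>T A *\<^sub>T X = X \<and>
     A *\<^sub>T X = X *\<^sub>T A"

definition tdrazin :: "('n::finite, 'n, 'p::{finite,linorder}) tensor
    \<Rightarrow> ('n, 'n, 'p) tensor" where
  "tdrazin A = (THE X. is_tdrazin A X)"

definition tcore :: "('n::finite, 'n, 'p::{finite,linorder}) tensor \<Rightarrow> nat
    \<Rightarrow> ('n, 'n, 'p) tensor" where
  "tcore A l = tpow A (l + 1) *\<^sub>T tdrazin A"

end

theory Submission
  imports Defs
begin

text \<open>
  Block circulant matrices turn the T-product into the matrix product, so square tensors form a
  finite-dimensional unital algebra over the complex numbers, and the theorem is an argument in that
  algebra.

  Let \<open>X\<close> be a Drazin inverse of \<open>A\<close>. Then \<open>X * A\<close> is idempotent, and \<open>C = X^(l+1)\<close> is a Drazin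
  inverse of \<open>B = A^(l+1)\<close> with the same projection \<open>C * B = X * A\<close>. On the image of this projection
  \<open>B\<close> is invertible with inverse \<open>C\<close>; on the complement \<open>B\<close> is nilpotent. Hence \<open>B + zI\<close> is
  invertible for all small \<open>z \<noteq> 0\<close> (\<open>eventually_tinvertible_shift\<close>). Its inverse may blow up on the
  nilpotent part, but not on a tensor \<open>T\<close> fixed by the projection: multiplying \<open>(B + zI) * R = T\<close> by
  \<open>C\<close> gives \<open>R + z C * R = C * T\<close>, so \<open>R\<close> stays bounded and tends to \<open>C * T\<close>
  (\<open>tendsto_resolvent_drazin\<close>). Both limits of the theorem are instances: \<open>A^l\<close> is fixed by \<open>X * A\<close>
  once \<open>l\<close> reaches the index, \<open>A^(l+1) * X\<close> is fixed for every \<open>l\<close>, and \<open>X^(l+1)\<close> sends either of them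
  to \<open>X\<close>.

  It remains to produce a Drazin inverse from an index that is defined by ranks of block circulant
  matrices. Equality of the ranks of \<open>M^k\<close> and \<open>M^(k+1)\<close> makes their row spaces equal, so
  \<open>A^(k+1) * U = A^(k+1) * V\<close> implies \<open>A^k * U = A^k * V\<close> (\<open>tpow_index_cancel\<close>). So left multiplication by \<open>A\<close> is injective on the
  right ideal generated by \<open>A^k\<close>, hence by dimension it maps this ideal onto itself, and
  \<open>A^k = A^(k+1) * B\<close> for some \<open>B\<close> (\<open>tpow_index_factor\<close>). Then \<open>A^k * B^(k+1)\<close> is a Drazin inverse.
\<close>

section \<open>The algebra of square tensors\<close>

text \<open>Subtraction modulo the number of slices, transported to the index type: \<open>bcirc\<close> reads off the
  slice at the difference of the two block indices.\<close>

definition slot_diff :: "'p \<Rightarrow> 'p \<Rightarrow> 'p::{finite,linorder}" where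
  "slot_diff i j =
     slice_at (nat ((int (slice_pos i) - int (slice_pos j)) mod int CARD('p)))"

lemma slice_pos_less: "slice_pos (i :: 'p::{finite,linorder}) < CARD('p)"
  using bij_betw_slice_pos by (auto simp: bij_betw_def)

lemma slice_pos_inject: "slice_pos i = slice_pos j \<longleftrightarrow> i = j"
  by (metis slice_at_slice_pos)

lemma slice_pos_slot_diff:
  fixes i j :: "'p::{finite,linorder}"
  shows "int (slice_pos (slot_diff i j)) = (int (slice_pos i) - int (slice_pos j)) mod int CARD('p)"
proof -
  let ?d = "(int (slice_pos i) - int (slice_pos j)) mod int CARD('p)"
  have "0 \<le> ?d" and "?d < int CARD('p)"
    by simp_all
  then have "nat ?d < CARD('p)"
    by linarith
  with \<open>0 \<le> ?d\<close> show ?thesis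
    by (simp add: slot_diff_def slice_pos_slice_at)
qed

lemma slot_diff_cancel:
  fixes i j q :: "'p::{finite,linorder}"
  shows "slot_diff (slot_diff i j) (slot_diff q j) = slot_diff i q"
proof -
  have "int (slice_pos (slot_diff (slot_diff i j) (slot_diff q j))) = int (slice_pos (slot_diff i q))"
    unfolding slice_pos_slot_diff by (simp add: mod_diff_eq)
  then show ?thesis
    by (simp add: slice_pos_inject)
qed

lemma slice_pos_slot_diff_eq_0:
  fixes i j :: "'p::{finite,linorder}"
  shows "slice_pos (slot_diff i j) = 0 \<longleftrightarrow> i = j"
proof -
  have "slice_pos (slot_diff i j) = 0 \<longleftrightarrow> int (slice_pos (slot_diff i j)) = 0"
    by simp
  also have "\<dots> \<longleftrightarrow> int (slice_pos i) mod int CARD('p) = int (slice_pos j) mod int CARD('p)"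
    unfolding slice_pos_slot_diff by (simp add: mod_eq_dvd_iff mod_eq_0_iff_dvd)
  also have "\<dots> \<longleftrightarrow> i = j"
    by (simp add: slice_pos_less slice_pos_inject)
  finally show ?thesis .
qed

lemma slot_diff_first:
  fixes i :: "'p::{finite,linorder}"
  shows "slot_diff i (slice_at 0) = i"
proof -
  have "int (slice_pos (slot_diff i (slice_at 0))) = int (slice_pos i)"
    unfolding slice_pos_slot_diff by (simp add: slice_pos_slice_at slice_pos_less)
  then show ?thesis
    by (simp add: slice_pos_inject)
qed

lemma bij_slot_diff: "bij (\<lambda>q::'p::{finite,linorder}. slot_diff q j)"
proof -
  have "inj (\<lambda>q::'p. slot_diff q j)"
    by (rule injI) (metis slot_diff_cancel slice_pos_slot_diff_eq_0)
  then show ?thesis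
    by (simp add: bij_def finite_UNIV_inj_surj)
qed

lemma bcirc_nth: "bcirc A $ ia $ jb = A $ slot_diff (fst ia) (fst jb) $ snd ia $ snd jb"
  by (simp add: bcirc_def slot_diff_def)

lemma tprod_nth:
  "(A *\<^sub>T B) $ i $ a $ b =
     (\<Sum>x\<in>UNIV. A $ slot_diff i (fst x) $ a $ snd x * B $ fst x $ snd x $ b)"
  by (simp add: tprod_def tfold_def tunfold_def matrix_matrix_mult_def bcirc_nth)

lemma bcirc_inject: "bcirc A = bcirc B \<longleftrightarrow> A = B"
proof
  assume eq: "bcirc A = bcirc B"
  have "A $ i $ a $ b = B $ i $ a $ b" for i a b
    using arg_cong[OF eq, of "\<lambda>M. M $ (i, a) $ (slice_at 0, b)"]
    by (simp add: bcirc_nth slot_diff_first)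
  then show "A = B"
    by (simp add: vec_eq_iff)
qed simp

text \<open>Entry \<open>((i,a), (j,b))\<close> of either side is a sum over the intermediate slice; translating that
  slice by \<open>j\<close> is a bijection of the slice positions and carries one sum to the other.\<close>

lemma bcirc_tprod:
  fixes A :: "('m::finite, 'n::finite, 'p::{finite,linorder}) tensor"
    and B :: "('n, 'q::finite, 'p) tensor"
  shows "bcirc (A *\<^sub>T B) = bcirc A ** bcirc B"
proof -
  have "bcirc (A *\<^sub>T B) $ ia $ jb = (bcirc A ** bcirc B) $ ia $ jb" for ia jb
  proof -
    let ?h = "\<lambda>x :: 'p \<times> 'n. (slot_diff (fst x) (fst jb), snd x)"
    let ?t = "\<lambda>x. A $ slot_diff (slot_diff (fst ia) (fst jb)) (fst x) $ snd ia $ snd x *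
                  B $ fst x $ snd x $ snd jb"
    have "inj ?h"
      using bij_slot_diff[of "fst jb"] by (auto simp: inj_on_def bij_def prod_eq_iff)
    then have "bij ?h"
      by (intro bijI finite_UNIV_inj_surj) simp_all
    then have "(\<Sum>x\<in>UNIV. ?t (?h x)) = (\<Sum>x\<in>UNIV. ?t x)"
      by (rule sum.reindex_bij_betw)
    then show ?thesis
      by (simp add: bcirc_nth tprod_nth matrix_matrix_mult_def slot_diff_cancel)
  qed
  then show ?thesis
    by (simp add: vec_eq_iff)
qed

lemma bcirc_tid: "bcirc tid = mat 1"
  by (auto simp: vec_eq_iff bcirc_nth tid_def mat_def slice_pos_slot_diff_eq_0 prod_eq_iff)

lemma tprod_assoc: "A *\<^sub>T B *\<^sub>T C = A *\<^sub>T (B *\<^sub>T C)"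
  by (simp add: tprod_def bcirc_tprod[unfolded tprod_def] matrix_mul_assoc)

lemma tid_left [simp]: "tid *\<^sub>T A = A"
  by (simp add: tprod_def bcirc_tid)

lemma tid_right [simp]: "A *\<^sub>T tid = A"
  by (simp add: bcirc_inject[symmetric] bcirc_tprod bcirc_tid)

lemma bcirc_tpow: "bcirc (tpow A k) = matpow (bcirc A) k"
  by (induction k) (simp_all add: bcirc_tid bcirc_tprod)

text \<open>This gives additivity, continuity and norm bounds of the product all at once. Bilinearity is
  over the reals; complex scalars are the subject of the \<open>tscale\<close> lemmas.\<close>

lemma bounded_bilinear_tprod:
  "bounded_bilinear
     ((*\<^sub>T) :: ('m::finite, 'n::finite, 'p::{finite,linorder}) tensor \<Rightarrow> ('n, 'q::finite, 'p) tensor \<Rightarrow> _)"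
  unfolding bilinear_conv_bounded_bilinear[symmetric] bilinear_def
  by (auto intro!: linearI simp: vec_eq_iff tprod_nth algebra_simps sum.distrib scaleR_sum_right)

interpretation tprod: bounded_bilinear "(*\<^sub>T)"
  by (rule bounded_bilinear_tprod)

lemma tprod_tscale_left: "tscale z A *\<^sub>T B = tscale z (A *\<^sub>T B)"
  by (simp add: vec_eq_iff tprod_nth tscale_def sum_distrib_left mult.assoc)

lemma tprod_tscale_right: "A *\<^sub>T tscale z B = tscale z (A *\<^sub>T B)"
  by (simp add: vec_eq_iff tprod_nth tscale_def sum_distrib_left algebra_simps)

lemma tscale_tscale: "tscale y (tscale z A) = tscale (y * z) A"
  by (simp add: vec_eq_iff tscale_def)

lemma tscale_one: "tscale 1 A = A"
  by (simp add: vec_eq_iff tscale_def)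

lemma tscale_minus_left: "tscale (- z) A = - tscale z A"
  by (simp add: vec_eq_iff tscale_def)

lemma norm_tscale: "norm (tscale z A) = cmod z * norm A"
  by (simp add: tscale_def norm_vec_def norm_mult L2_set_left_distrib
      flip: L2_set_right_distrib)

lemma tpow_add: "tpow A (i + j) = tpow A i *\<^sub>T tpow A j"
  by (induction i) (simp_all add: tprod_assoc)

lemma tpow_mult: "tpow A (i * j) = tpow (tpow A i) j"
  by (induction j) (simp_all add: tpow_add)

lemma tpow_commute:
  assumes "A *\<^sub>T B = B *\<^sub>T A"
  shows "tpow A j *\<^sub>T B = B *\<^sub>T tpow A j"
proof (induction j)
  case (Suc j)
  have "tpow A (Suc j) *\<^sub>T B = (A *\<^sub>T B) *\<^sub>T tpow A j"
    by (simp add: tprod_assoc Suc)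
  then show ?case
    by (simp add: assms tprod_assoc)
qed simp

section \<open>Consequences of rank stabilisation\<close>

lemma rows_mult_subset_span: "rows (M ** N) \<subseteq> vec.span (rows (N :: 'a::field ^ 'n ^ 'm))"
proof -
  have "row i (M ** N) = (\<Sum>j\<in>UNIV. M $ i $ j *s row j N)" for i
    by (simp add: vec_eq_iff row_def matrix_matrix_mult_def)
  moreover have "(\<Sum>j\<in>UNIV. M $ i $ j *s row j N) \<in> vec.span (rows N)" for i
    by (intro vec.span_sum vec.span_scale vec.span_base) (auto simp: rows_def)
  ultimately show ?thesis
    by (auto simp: rows_def)
qed

lemma rank_mult_le: "rank (M ** N) \<le> rank (N :: 'a::field ^ 'n ^ 'm)"
  unfolding row_rank_def_gen
  by (metis rows_mult_subset_span vec.dim_span vec.dim_subset)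

text \<open>The row space of \<open>M ** N\<close> lies in that of \<open>N\<close>, so equal ranks make them equal. The rows whose
  product with a given column of \<open>U\<close> vanishes form a subspace; it contains the rows of \<open>M ** N\<close>, hence
  those of \<open>N\<close>. Row spaces are used because \<open>rank\<close> is defined as row rank over a general field.\<close>

lemma cancel_left_factor_of_rank_eq:
  fixes M :: "'a::field ^ 'm ^ 'l" and N :: "'a ^ 'n ^ 'm" and U :: "'a ^ 'q ^ 'n"
  assumes rank: "rank (M ** N) = rank N" and zero: "M ** N ** U = 0"
  shows "N ** U = 0"
proof -
  have "vec.span (rows (M ** N)) = vec.span (vec.span (rows N))"
    using rank rows_mult_subset_span[of M N]
    by (intro vec.dim_eq_span) (simp_all add: row_rank_def_gen)
  then have span: "vec.span (rows (M ** N)) = vec.span (rows N)"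
    by simp
  have "(N ** U) $ i $ b = 0" for i b
  proof -
    let ?K = "{r. (\<Sum>c\<in>UNIV. r $ c * U $ c $ b) = 0}"
    have "vec.subspace ?K"
      by (auto simp: vec.subspace_def distrib_right sum.distrib mult.assoc simp flip: sum_distrib_left)
    moreover have "rows (M ** N) \<subseteq> ?K"
    proof -
      have "(\<Sum>c\<in>UNIV. row j (M ** N) $ c * U $ c $ b) = (M ** N ** U) $ j $ b" for j
        by (simp add: row_def matrix_matrix_mult_def)
      then show ?thesis
        by (auto simp: rows_def zero)
    qed
    ultimately have "vec.span (rows N) \<subseteq> ?K"
      unfolding span[symmetric] by (intro vec.span_minimal)
    moreover have "row i N \<in> vec.span (rows N)"
      by (rule vec.span_base) (auto simp: rows_def)
    ultimately have "row i N \<in> ?K"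
      by blast
    then show ?thesis
      by (simp add: row_def matrix_matrix_mult_def)
  qed
  then show ?thesis
    by (simp add: vec_eq_iff)
qed

text \<open>The ranks of the powers cannot decrease strictly forever, so the least exponent in the
  definition of the index exists.\<close>

lemma rank_matpow_mat_index:
  "rank (matpow M (Suc (mat_index M))) = rank (matpow M (mat_index M))"
proof -
  let ?r = "\<lambda>k. rank (matpow M k)"
  let ?P = "\<lambda>k. 1 \<le> k \<and> ?r k = ?r (k + 1)"
  have "\<exists>k. ?P k"
  proof (rule ccontr)
    assume "\<not> (\<exists>k. ?P k)"
    then have less: "?r (Suc k) < ?r k" if "1 \<le> k" for k
      using that rank_mult_le[of M "matpow M k"] by (fastforce simp: le_less)
    have "?r (Suc k) + k \<le> ?r 1" for k
    proof (induction k)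
      case (Suc k)
      then show ?case
        using less[of "Suc k"] by simp
    qed simp
    \<comment> \<open>The decrease starts at exponent 1, so \<open>?r 1 + 1\<close> further steps would make the rank negative.\<close>
    from this[of "Suc (?r 1)"] show False
      by simp
  qed
  then have "?P (LEAST k. ?P k)"
    by (rule LeastI_ex)
  then show ?thesis
    unfolding mat_index_def by simp
qed

lemma tpow_index_cancel:
  assumes "tpow A (Suc (tindex A)) *\<^sub>T U = tpow A (Suc (tindex A)) *\<^sub>T V"
  shows "tpow A (tindex A) *\<^sub>T U = tpow A (tindex A) *\<^sub>T V"
proof -
  let ?M = "bcirc A" and ?N = "matpow (bcirc A) (tindex A)"
  have "tpow A (Suc (tindex A)) *\<^sub>T (U - V) = 0"
    using assms by (simp add: tprod.diff_right)
  then have "bcirc (tpow A (Suc (tindex A))) ** tunfold (U - V) = tunfold 0"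
    unfolding tprod_def by (metis tunfold_tfold)
  then have "?M ** ?N ** tunfold (U - V) = 0"
    by (simp add: bcirc_tprod bcirc_tpow) (simp add: tunfold_def vec_eq_iff)
  moreover have "rank (?M ** ?N) = rank ?N"
    using rank_matpow_mat_index[of ?M] by (simp add: tindex_def)
  ultimately have "?N ** tunfold (U - V) = 0"
    by (rule cancel_left_factor_of_rank_eq[rotated])
  then have "tpow A (tindex A) *\<^sub>T (U - V) = 0"
    by (simp add: tprod_def bcirc_tpow) (simp add: tfold_def vec_eq_iff)
  then show ?thesis
    by (simp add: tprod.diff_right)
qed

text \<open>Let \<open>S\<close> be the right ideal generated by \<open>A^k\<close>, where \<open>k\<close> is the index. Multiplication by \<open>A\<close>
  maps \<open>S\<close> into itself, and by \<open>tpow_index_cancel\<close> it is injective there. Since \<open>S\<close> has finite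
  dimension it is onto, and in particular reaches \<open>A^k\<close>.\<close>

lemma tpow_index_factor:
  fixes A :: "('n::finite, 'n, 'p::{finite,linorder}) tensor"
  shows "\<exists>B. tpow A (tindex A) = tpow A (Suc (tindex A)) *\<^sub>T B"
proof -
  let ?k = "tindex A"
  let ?S = "range (\<lambda>U :: ('n, 'n, 'p) tensor. tpow A ?k *\<^sub>T U)"
  have lin: "linear (\<lambda>U :: ('n, 'n, 'p) tensor. B *\<^sub>T U)" for B :: "('n, 'n, 'p) tensor"
    by (simp add: bounded_linear.linear tprod.bounded_linear_right)
  have sub: "subspace ?S"
    by (rule linear_subspace_image[OF lin subspace_UNIV])
  have comm: "A *\<^sub>T (tpow A ?k *\<^sub>T U) = tpow A ?k *\<^sub>T (A *\<^sub>T U)"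
    for U :: "('n, 'n, 'p) tensor"
    using tpow_commute[of A A ?k] by (simp flip: tprod_assoc)
  have "inj_on ((*\<^sub>T) A) (span ?S)"
    unfolding span_eq_iff[THEN iffD2, OF sub]
    using tpow_index_cancel by (auto simp: inj_on_def tprod_assoc)
  then have "dim ((*\<^sub>T) A ` ?S) = dim ?S"
    by (rule dim_image_eq[OF lin])
  moreover have "(*\<^sub>T) A ` ?S \<subseteq> ?S"
    by (auto simp: comm)
  ultimately have "(*\<^sub>T) A ` ?S = ?S"
    by (intro subspace_dim_equal linear_subspace_image lin sub) simp_all
  moreover have "tpow A ?k \<in> ?S"
    by (metis rangeI tid_right)
  ultimately show ?thesis
    by (auto simp: image_iff tprod_assoc)
qed

section \<open>Drazin inverses\<close>

text \<open>The exponent is a parameter rather than the index of \<open>A\<close>: in this form the notion passes to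
  powers of \<open>A\<close> with the exponent unchanged, and their indices never have to be computed.\<close>

definition drazin_inverse_at ::
  "nat \<Rightarrow> ('n::finite, 'n, 'p::{finite,linorder}) tensor \<Rightarrow> ('n, 'n, 'p) tensor \<Rightarrow> bool" where
  "drazin_inverse_at m A X \<longleftrightarrow>
     tpow A m *\<^sub>T X *\<^sub>T A = tpow A m \<and> X *\<^sub>T A *\<^sub>T X = X \<and> A *\<^sub>T X = X *\<^sub>T A"

lemma is_tdrazin_iff: "is_tdrazin A X \<longleftrightarrow> drazin_inverse_at (tindex A) A X"
  by (simp add: is_tdrazin_def drazin_inverse_at_def)

text \<open>If \<open>A\<close> and \<open>B\<close> commuted, \<open>A^k = A^(k+1) * B\<close> would make \<open>A^k * B^(k+1)\<close> a Drazin inverse at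
  once. The factor \<open>B\<close> need not commute with \<open>A\<close>; instead, an equation between right multiples of
  \<open>A^k\<close> is proved after multiplication by a power of \<open>A\<close>, where the superfluous factors \<open>B\<close> are
  absorbed, and the power is then cancelled.\<close>

lemma ex_drazin_inverse: "\<exists>X. drazin_inverse_at (tindex A) A X"
proof -
  define k where "k = tindex A"
  obtain B where B: "tpow A k = tpow A (Suc k) *\<^sub>T B"
    using tpow_index_factor unfolding k_def by blast
  have pow: "tpow A (m + k) *\<^sub>T tpow B m = tpow A k" for m
  proof (induction m)
    case (Suc m)
    have "tpow A (Suc m + k) *\<^sub>T tpow B (Suc m) = tpow A m *\<^sub>T (tpow A (Suc k) *\<^sub>T B) *\<^sub>T tpow B m"
      using tpow_add[of A m "Suc k"] by (simp add: tprod_assoc)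
    also have "\<dots> = tpow A (m + k) *\<^sub>T tpow B m"
      by (simp only: B[symmetric] tpow_add)
    finally show ?case
      using Suc by simp
  qed simp
  have cancel: "tpow A k *\<^sub>T U = tpow A k *\<^sub>T V"
    if "tpow A (m + k) *\<^sub>T U = tpow A (m + k) *\<^sub>T V" for m U V
    using that
  proof (induction m)
    case (Suc m)
    have "tpow A (Suc k) *\<^sub>T (tpow A m *\<^sub>T U) = tpow A (Suc k) *\<^sub>T (tpow A m *\<^sub>T V)"
      using Suc.prems by (simp add: add.commute[of m k] tpow_add tprod_assoc)
    then have "tpow A k *\<^sub>T (tpow A m *\<^sub>T U) = tpow A k *\<^sub>T (tpow A m *\<^sub>T V)"
      unfolding k_def by (rule tpow_index_cancel)
    then have "tpow A (m + k) *\<^sub>T U = tpow A (m + k) *\<^sub>T V"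
      by (simp add: add.commute[of m k] tpow_add tprod_assoc)
    then show ?case
      by (rule Suc.IH)
  qed simp
  define X where "X = tpow A k *\<^sub>T tpow B (Suc k)"
  have AX: "A *\<^sub>T X = tpow A k *\<^sub>T tpow B k"
  proof -
    have "A *\<^sub>T X = (tpow A (Suc k) *\<^sub>T B) *\<^sub>T tpow B k"
      by (simp add: X_def tprod_assoc)
    then show ?thesis
      by (simp only: B[symmetric])
  qed
  \<comment> \<open>Both sides are right multiples of \<open>A^k\<close>, and left multiplication by
    \<open>A^(k+1)\<close> turns both into \<open>A^(k+1)\<close>.\<close>
  have comm: "A *\<^sub>T X = X *\<^sub>T A"
  proof -
    have "tpow A (Suc k + k) *\<^sub>T tpow B k = tpow A (Suc k + k) *\<^sub>T (tpow B (Suc k) *\<^sub>T A)"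
    proof -
      have "tpow A (Suc k + k) *\<^sub>T tpow B k = tpow A (Suc k)"
        using pow[of k] by (simp add: tprod_assoc)
      also have "\<dots> = tpow A k *\<^sub>T A"
        using tpow_commute[of A A k] by simp
      also have "\<dots> = tpow A (Suc k + k) *\<^sub>T (tpow B (Suc k) *\<^sub>T A)"
        using pow[of "Suc k"] by (simp flip: tprod_assoc)
      finally show ?thesis .
    qed
    then have "tpow A k *\<^sub>T tpow B k = tpow A k *\<^sub>T (tpow B (Suc k) *\<^sub>T A)"
      by (rule cancel)
    then show ?thesis
      by (subst AX) (simp add: X_def tprod_assoc)
  qed
  have absorb: "tpow A k *\<^sub>T X *\<^sub>T A = tpow A k"
  proof -
    have "tpow A k *\<^sub>T (A *\<^sub>T X) = tpow A (k + k) *\<^sub>T tpow B k"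
      by (simp add: AX tpow_add tprod_assoc)
    then show ?thesis
      by (simp add: pow tprod_assoc flip: comm)
  qed
  have "X *\<^sub>T A *\<^sub>T X = X"
  proof -
    have "tpow A k *\<^sub>T (X *\<^sub>T A) = X *\<^sub>T A *\<^sub>T tpow A k"
      by (rule tpow_commute) (metis comm tprod_assoc)
    then have "X *\<^sub>T A *\<^sub>T tpow A k = tpow A k"
      using absorb by (simp add: tprod_assoc)
    then show ?thesis
      unfolding X_def by (simp flip: tprod_assoc)
  qed
  with absorb comm show ?thesis
    unfolding drazin_inverse_at_def k_def by blast
qed

lemma drazin_inverse_tpow_Suc:
  assumes "drazin_inverse_at m A X"
  shows "tpow X (Suc l) *\<^sub>T tpow A (Suc l) = X *\<^sub>T A"
    and "tpow A (Suc l) *\<^sub>T tpow X (Suc l) = X *\<^sub>T A"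
proof -
  have comm: "A *\<^sub>T X = X *\<^sub>T A" and inner: "X *\<^sub>T A *\<^sub>T X = X"
    using assms by (simp_all add: drazin_inverse_at_def)
  show "tpow X (Suc l) *\<^sub>T tpow A (Suc l) = X *\<^sub>T A"
  proof (induction l)
    case (Suc l)
    have "tpow X (Suc (Suc l)) *\<^sub>T tpow A (Suc (Suc l)) =
        X *\<^sub>T (tpow X (Suc l) *\<^sub>T tpow A (Suc l)) *\<^sub>T A"
      using tpow_commute[of A A "Suc l"] by (simp add: tprod_assoc)
    also have "\<dots> = X *\<^sub>T A *\<^sub>T X *\<^sub>T A"
      unfolding Suc by (metis comm tprod_assoc)
    finally show ?case
      by (simp add: inner)
  qed simp
  moreover have "tpow X (Suc l) *\<^sub>T tpow A (Suc l) = tpow A (Suc l) *\<^sub>T tpow X (Suc l)"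
    by (rule tpow_commute[OF tpow_commute[OF comm, symmetric]])
  ultimately show "tpow A (Suc l) *\<^sub>T tpow X (Suc l) = X *\<^sub>T A"
    by simp
qed

text \<open>The exponent \<open>m\<close> still serves for the power because \<open>(A^(l+1))^m\<close> is a multiple of \<open>A^m\<close>.\<close>

lemma drazin_inverse_at_tpow_Suc:
  assumes "drazin_inverse_at m A X"
  shows "drazin_inverse_at m (tpow A (Suc l)) (tpow X (Suc l))"
proof -
  have absorb: "tpow A m *\<^sub>T X *\<^sub>T A = tpow A m" and inner: "X *\<^sub>T A *\<^sub>T X = X"
    using assms by (simp_all add: drazin_inverse_at_def)
  note proj = drazin_inverse_tpow_Suc[OF assms, of l]
  have "tpow (tpow A (Suc l)) m = tpow A (l * m) *\<^sub>T tpow A m"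
    by (simp only: tpow_mult[symmetric] tpow_add[symmetric]) (simp add: add.commute)
  then have "tpow (tpow A (Suc l)) m *\<^sub>T (X *\<^sub>T A) = tpow (tpow A (Suc l)) m"
    using absorb by (simp only: tprod_assoc)
  then have "tpow (tpow A (Suc l)) m *\<^sub>T tpow X (Suc l) *\<^sub>T tpow A (Suc l) = tpow (tpow A (Suc l)) m"
    using proj by (simp only: tprod_assoc)
  moreover have "tpow X (Suc l) *\<^sub>T tpow A (Suc l) *\<^sub>T tpow X (Suc l) = tpow X (Suc l)"
    unfolding proj(1) using inner by (simp flip: tprod_assoc)
  ultimately show ?thesis
    unfolding drazin_inverse_at_def using proj by simp
qed

lemma drazin_inverse_tpow_absorb:
  assumes "drazin_inverse_at m A X"
  shows "tpow X (Suc l) *\<^sub>T tpow A l = X"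
    and "tpow A l *\<^sub>T tpow X (Suc l) = X"
proof -
  have comm: "A *\<^sub>T X = X *\<^sub>T A" and inner: "X *\<^sub>T A *\<^sub>T X = X"
    using assms by (simp_all add: drazin_inverse_at_def)
  show "tpow X (Suc l) *\<^sub>T tpow A l = X"
  proof (cases l)
    case (Suc j)
    have "tpow X (Suc l) *\<^sub>T tpow A l = X *\<^sub>T (X *\<^sub>T A)"
      using drazin_inverse_tpow_Suc(1)[OF assms, of j] by (simp add: Suc tprod_assoc)
    also have "\<dots> = X *\<^sub>T A *\<^sub>T X"
      unfolding tprod_assoc[of X A X] comm ..
    finally show ?thesis
      by (simp only: inner)
  qed simp
  moreover have "tpow X (Suc l) *\<^sub>T tpow A l = tpow A l *\<^sub>T tpow X (Suc l)"
    by (rule tpow_commute[OF tpow_commute[OF comm, symmetric]])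
  ultimately show "tpow A l *\<^sub>T tpow X (Suc l) = X"
    by simp
qed

lemma drazin_projection_commute:
  assumes "drazin_inverse_at m A X"
  shows "X *\<^sub>T A *\<^sub>T tpow A l = tpow A l *\<^sub>T (X *\<^sub>T A)"
proof -
  have "A *\<^sub>T (X *\<^sub>T A) = X *\<^sub>T A *\<^sub>T A"
    using assms by (simp add: drazin_inverse_at_def flip: tprod_assoc)
  then show ?thesis
    by (rule tpow_commute[symmetric])
qed

text \<open>Both inverses equal \<open>X * A * Y\<close>: writing \<open>X = X^(m+1) * A^m\<close> lets \<open>A^m\<close> absorb \<open>A * Y\<close>, and
  writing \<open>Y = A^m * Y^(m+1)\<close> lets \<open>A^m\<close> absorb \<open>X * A\<close>.\<close>

lemma drazin_inverse_at_unique: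
  assumes X: "drazin_inverse_at m A X" and Y: "drazin_inverse_at m A Y"
  shows "X = Y"
proof -
  have X_absorb: "tpow A m *\<^sub>T (X *\<^sub>T A) = tpow A m"
    using X by (simp add: drazin_inverse_at_def tprod_assoc)
  have Y_absorb: "tpow A m *\<^sub>T (A *\<^sub>T Y) = tpow A m"
    using Y by (simp add: drazin_inverse_at_def tprod_assoc)
  have "X *\<^sub>T (A *\<^sub>T Y) = tpow X (Suc m) *\<^sub>T (tpow A m *\<^sub>T (A *\<^sub>T Y))"
    unfolding tprod_assoc[symmetric] drazin_inverse_tpow_absorb(1)[OF X] ..
  also have "\<dots> = X"
    unfolding Y_absorb by (rule drazin_inverse_tpow_absorb(1)[OF X])
  finally have left: "X *\<^sub>T (A *\<^sub>T Y) = X" .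
  have "X *\<^sub>T (A *\<^sub>T Y) = X *\<^sub>T A *\<^sub>T tpow A m *\<^sub>T tpow Y (Suc m)"
    by (simp only: tprod_assoc drazin_inverse_tpow_absorb(2)[OF Y])
  also have "\<dots> = Y"
    unfolding drazin_projection_commute[OF X] X_absorb
    by (rule drazin_inverse_tpow_absorb(2)[OF Y])
  finally show ?thesis
    using left by simp
qed

lemma drazin_inverse_at_tdrazin: "drazin_inverse_at (tindex A) A (tdrazin A)"
proof -
  have "\<exists>!X. is_tdrazin A X"
    using ex_drazin_inverse drazin_inverse_at_unique unfolding is_tdrazin_iff by blast
  then have "is_tdrazin A (tdrazin A)"
    unfolding tdrazin_def by (rule theI')
  then show ?thesis
    by (simp add: is_tdrazin_iff)
qed

section \<open>The resolvent near the origin\<close>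

lemma
  assumes "tinvertible A"
  shows tprod_tinv: "A *\<^sub>T tinv A = tid" and tinv_tprod: "tinv A *\<^sub>T A = tid"
proof -
  have "X = Y" if "is_tinverse A X" "is_tinverse A Y" for X Y
    using that unfolding is_tinverse_def by (metis tid_left tid_right tprod_assoc)
  then have "\<exists>!X. is_tinverse A X"
    using assms unfolding tinvertible_def by blast
  then have "is_tinverse A (tinv A)"
    unfolding tinv_def by (rule theI')
  then show "A *\<^sub>T tinv A = tid" and "tinv A *\<^sub>T A = tid"
    by (simp_all add: is_tinverse_def)
qed

text \<open>An injective endomorphism of a finite-dimensional space is onto, which gives a right inverse;
  cancelling \<open>A\<close> shows that it is also a left inverse.\<close>

lemma tinvertible_of_trivial_kernel:
  fixes A :: "('n::finite, 'n, 'p::{finite,linorder}) tensor"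
  assumes kernel: "\<And>U :: ('n, 'n, 'p) tensor. A *\<^sub>T U = 0 \<Longrightarrow> U = 0"
  shows "tinvertible A"
proof -
  let ?L = "\<lambda>U :: ('n, 'n, 'p) tensor. A *\<^sub>T U"
  have lin: "linear ?L"
    by (simp add: bounded_linear.linear tprod.bounded_linear_right)
  then have inj: "inj ?L"
    using kernel by (simp add: linear_injective_0)
  then have "surj ?L"
    by (rule linear_injective_imp_surjective[OF lin]) (rule refl)
  then obtain X where X: "A *\<^sub>T X = tid"
    by (metis surjD)
  then have "A *\<^sub>T (X *\<^sub>T A) = A *\<^sub>T tid"
    by (simp flip: tprod_assoc)
  with inj have "X *\<^sub>T A = tid"
    by (rule injD)
  with X show ?thesis
    by (auto simp: tinvertible_def is_tinverse_def)
qed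

lemma shift_tprod: "(B + tscale z tid) *\<^sub>T U = B *\<^sub>T U + tscale z U"
  by (simp add: tprod.add_left tprod_tscale_left)

lemma eventually_norm_mult_less:
  fixes K :: real
  assumes "0 < K" and "0 < e"
  shows "\<forall>\<^sub>F z in at (0::complex). cmod z * K < e"
proof -
  have "((\<lambda>z::complex. cmod z * K) \<longlongrightarrow> cmod 0 * K) (at 0)"
    by (intro tendsto_intros)
  then show ?thesis
    using assms by (intro order_tendstoD) auto
qed

text \<open>If \<open>B * U = -z U\<close>, the component \<open>V = C * B * U\<close> of \<open>U\<close> in the image of the projection satisfies
  \<open>V = -z C * V\<close>, so it vanishes when \<open>\<bar>z\<bar> K < 1\<close>. Then \<open>U\<close> lies in the nilpotent part,
  \<open>0 = B^m * U = (-z)^m U\<close>, and \<open>U = 0\<close> because \<open>z \<noteq> 0\<close>.\<close>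

lemma drazin_shift_kernel:
  fixes B C U :: "('n::finite, 'n, 'p::{finite,linorder}) tensor"
  assumes drazin: "drazin_inverse_at m B C"
    and bound: "\<And>U :: ('n, 'n, 'p) tensor. norm (C *\<^sub>T U) \<le> norm U * K"
    and small: "cmod z * K < 1" and "z \<noteq> 0"
    and zero: "(B + tscale z tid) *\<^sub>T U = 0"
  shows "U = 0"
proof -
  have absorb: "tpow B m *\<^sub>T C *\<^sub>T B = tpow B m" and inner: "C *\<^sub>T B *\<^sub>T C = C" and comm: "B *\<^sub>T C = C *\<^sub>T B"
    using drazin by (simp_all add: drazin_inverse_at_def)
  have BU: "B *\<^sub>T U = tscale (- z) U"
    using zero by (simp add: shift_tprod tscale_minus_left eq_neg_iff_add_eq_0)
  define V where "V = C *\<^sub>T (B *\<^sub>T U)"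
  have "V = tscale (- z) (C *\<^sub>T V)"
  proof -
    have "C *\<^sub>T V = C *\<^sub>T U"
      unfolding V_def
      by (simp only: tprod_assoc[symmetric], subst tprod_assoc)
        (simp only: comm[symmetric], simp only: tprod_assoc[symmetric] inner)
    moreover have "V = tscale (- z) (C *\<^sub>T U)"
      by (simp add: V_def BU tprod_tscale_right)
    ultimately show ?thesis
      by simp
  qed
  then have "norm V = cmod z * norm (C *\<^sub>T V)"
    by (rule arg_cong[of _ _ norm, THEN trans]) (simp add: norm_tscale)
  also have "\<dots> \<le> cmod z * (norm V * K)"
    by (intro mult_left_mono bound) simp
  finally have "norm V * (1 - cmod z * K) \<le> 0"
    by (simp add: algebra_simps)
  then have "V = 0"
    using small by (simp add: mult_le_0_iff)
  then have "tpow B m *\<^sub>T U = 0"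
    using absorb unfolding V_def by (metis tprod_assoc tprod.zero_right)
  moreover have "tpow B j *\<^sub>T U = tscale ((- z) ^ j) U" for j
    by (induction j) (simp_all add: tscale_one tprod_assoc tprod_tscale_right BU tscale_tscale mult.commute)
  ultimately have "norm (tscale ((- z) ^ m) U) = 0"
    by simp
  then show ?thesis
    using \<open>z \<noteq> 0\<close> by (simp add: norm_tscale)
qed

lemma eventually_tinvertible_shift:
  fixes B C :: "('n::finite, 'n, 'p::{finite,linorder}) tensor"
  assumes "drazin_inverse_at m B C"
  shows "\<forall>\<^sub>F z in at 0. tinvertible (B + tscale z tid)"
proof -
  obtain K where "0 < K" and K: "\<And>U :: ('n, 'n, 'p) tensor. norm (C *\<^sub>T U) \<le> norm U * K"
    using bounded_linear.pos_bounded[OF tprod.bounded_linear_right[of C]] by blast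
  have "\<forall>\<^sub>F z in at (0::complex). z \<noteq> 0"
    by (simp add: eventually_neq_at_within)
  with eventually_norm_mult_less[OF \<open>0 < K\<close> zero_less_one] show ?thesis
  proof eventually_elim
    case (elim z)
    show ?case
      by (rule tinvertible_of_trivial_kernel, rule drazin_shift_kernel[OF assms K elim])
  qed
qed

text \<open>The value \<open>R\<close> of the resolvent at \<open>T\<close> inherits \<open>C * B * R = R\<close> from \<open>T\<close>, so multiplying
  \<open>(B + zI) * R = T\<close> by \<open>C\<close> gives \<open>C * T = R + z C * R\<close>. For \<open>\<bar>z\<bar> K < 1/2\<close> this bounds \<open>R\<close> by
  \<open>2 \<bar>C * T\<bar>\<close>, and then the error \<open>z C * R\<close> is of order \<open>z\<close>.\<close>

lemma tendsto_resolvent_drazin: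
  fixes B C :: "('n::finite, 'n, 'p::{finite,linorder}) tensor" and T :: "('n, 'q::finite, 'p) tensor"
  assumes drazin: "drazin_inverse_at m B C" and fixed: "C *\<^sub>T B *\<^sub>T T = T"
  shows "((\<lambda>z. tinv (B + tscale z tid) *\<^sub>T T) \<longlongrightarrow> C *\<^sub>T T) (at 0)"
proof -
  let ?N = "\<lambda>z. B + tscale z tid"
  let ?R = "\<lambda>z. tinv (?N z) *\<^sub>T T"
  have comm: "B *\<^sub>T C = C *\<^sub>T B"
    using drazin by (simp add: drazin_inverse_at_def)
  obtain K where "0 < K" and K: "\<And>U :: ('n, 'q, 'p) tensor. norm (C *\<^sub>T U) \<le> norm U * K"
    using bounded_linear.pos_bounded[OF tprod.bounded_linear_right[of C]] by blast
  have "\<forall>\<^sub>F z in at 0. norm (?R z - C *\<^sub>T T) \<le> cmod z * (2 * norm (C *\<^sub>T T) * K)"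
    using eventually_tinvertible_shift[OF drazin] eventually_norm_mult_less[OF \<open>0 < K\<close> half_gt_zero[OF zero_less_one]]
  proof eventually_elim
    case (elim z)
    let ?R = "?R z"
    have NR: "?N z *\<^sub>T ?R = T"
      using tprod_tinv[OF elim(1)] by (simp flip: tprod_assoc)
    have "C *\<^sub>T B *\<^sub>T ?R = ?R"
    proof -
      have "?N z *\<^sub>T (C *\<^sub>T B *\<^sub>T ?R) = C *\<^sub>T B *\<^sub>T (?N z *\<^sub>T ?R)"
        by (simp add: shift_tprod tprod.add_right tprod_tscale_right)
          (metis comm tprod_assoc)
      also have "\<dots> = ?N z *\<^sub>T ?R"
        by (simp add: NR fixed)
      finally have "tinv (?N z) *\<^sub>T ?N z *\<^sub>T (C *\<^sub>T B *\<^sub>T ?R) = tinv (?N z) *\<^sub>T ?N z *\<^sub>T ?R"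
        unfolding tprod_assoc by (rule arg_cong)
      then show ?thesis
        unfolding tinv_tprod[OF elim(1)] tid_left .
    qed
    moreover have "C *\<^sub>T (?N z *\<^sub>T ?R) = C *\<^sub>T B *\<^sub>T ?R + tscale z (C *\<^sub>T ?R)"
      by (simp add: shift_tprod tprod.add_right tprod_tscale_right tprod_assoc)
    ultimately have diff: "C *\<^sub>T T = ?R + tscale z (C *\<^sub>T ?R)"
      by (simp add: NR)
    have err: "norm (tscale z (C *\<^sub>T ?R)) \<le> cmod z * (norm ?R * K)"
      unfolding norm_tscale by (intro mult_left_mono K) simp
    also have "\<dots> \<le> norm ?R / 2"
      using mult_left_mono[of "cmod z * K" "1/2" "norm ?R"] elim(2) by (simp add: mult_ac)
    finally have "norm ?R \<le> 2 * norm (C *\<^sub>T T)"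
      using norm_diff_ineq[of ?R "tscale z (C *\<^sub>T ?R)"] unfolding diff by simp
    then have "cmod z * (norm ?R * K) \<le> cmod z * (2 * norm (C *\<^sub>T T) * K)"
      using \<open>0 < K\<close> by (intro mult_left_mono mult_right_mono) auto
    moreover have "norm (?R - C *\<^sub>T T) = norm (tscale z (C *\<^sub>T ?R))"
      unfolding diff by simp
    ultimately show ?case
      using err by simp
  qed
  moreover have "((\<lambda>z. cmod z * (2 * norm (C *\<^sub>T T) * K)) \<longlongrightarrow> 0) (at 0)"
    by (auto intro!: tendsto_eq_intros)
  ultimately have "((\<lambda>z. ?R z - C *\<^sub>T T) \<longlongrightarrow> 0) (at 0)"
    by (rule Lim_null_comparison)
  then show ?thesis
    by (rule LIM_zero_cancel)
qed

theorem theorem17: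
  fixes A :: "('n::finite, 'n, 'p::{finite,linorder}) tensor" and k :: nat
  assumes "tindex A = k"
  shows "(\<forall>l\<ge>k.
            (\<forall>\<^sub>F z in at 0. tinvertible (tpow A (l + 1) + tscale z tid)) \<and>
            ((\<lambda>z. tinv (tpow A (l + 1) + tscale z tid) *\<^sub>T tpow A l) \<longlongrightarrow> tdrazin A) (at 0)) \<and>
         (\<forall>l::nat.
            (\<forall>\<^sub>F z in at 0. tinvertible (tpow A (l + 1) + tscale z tid)) \<and>
            ((\<lambda>z. tinv (tpow A (l + 1) + tscale z tid) *\<^sub>T tcore A l) \<longlongrightarrow> tdrazin A) (at 0))"
proof -
  define X where "X = tdrazin A"
  have drazin: "drazin_inverse_at k A X"
    using drazin_inverse_at_tdrazin[of A] assms by (simp add: X_def)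
  then have absorb: "tpow A k *\<^sub>T X *\<^sub>T A = tpow A k" and inner: "X *\<^sub>T A *\<^sub>T X = X"
    by (simp_all add: drazin_inverse_at_def)
  have power: "drazin_inverse_at k (tpow A (l + 1)) (tpow X (l + 1))" for l
    using drazin_inverse_at_tpow_Suc[OF drazin, of l] by simp
  have proj: "tpow X (l + 1) *\<^sub>T tpow A (l + 1) = X *\<^sub>T A" for l
    using drazin_inverse_tpow_Suc(1)[OF drazin, of l] by simp
  note proj_comm = drazin_projection_commute[OF drazin]
  have first: "((\<lambda>z. tinv (tpow A (l + 1) + tscale z tid) *\<^sub>T tpow A l) \<longlongrightarrow> X) (at 0)"
    if "k \<le> l" for l
  proof -
    obtain j where l: "l = j + k"
      using le_add_diff_inverse2[OF \<open>k \<le> l\<close>] by metis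
    have "tpow A l *\<^sub>T (X *\<^sub>T A) = tpow A l"
      using absorb by (simp add: l tpow_add tprod_assoc)
    then have fixed: "tpow X (l + 1) *\<^sub>T tpow A (l + 1) *\<^sub>T tpow A l = tpow A l"
      by (simp only: proj proj_comm)
    have "tpow X (l + 1) *\<^sub>T tpow A l = X"
      using drazin_inverse_tpow_absorb(1)[OF drazin, of l] by simp
    then show ?thesis
      using tendsto_resolvent_drazin[OF power fixed] by simp
  qed
  have second: "((\<lambda>z. tinv (tpow A (l + 1) + tscale z tid) *\<^sub>T tcore A l) \<longlongrightarrow> X) (at 0)" for l
  proof -
    have core: "tcore A l = tpow A (l + 1) *\<^sub>T X"
      by (simp only: tcore_def X_def)
    have "X *\<^sub>T A *\<^sub>T tpow A (l + 1) *\<^sub>T X = tpow A (l + 1) *\<^sub>T (X *\<^sub>T A *\<^sub>T X)"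
      unfolding proj_comm by (simp only: tprod_assoc)
    then have fixed: "tpow X (l + 1) *\<^sub>T tpow A (l + 1) *\<^sub>T tcore A l = tcore A l"
      unfolding core proj inner by (simp only: tprod_assoc)
    have "tpow X (l + 1) *\<^sub>T tcore A l = X"
      using inner by (simp only: core proj flip: tprod_assoc)
    then show ?thesis
      using tendsto_resolvent_drazin[OF power fixed] by simp
  qed
  show ?thesis
    using first second eventually_tinvertible_shift[OF power] unfolding X_def by blast
qed

end
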